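(* Let $N\ge 1$, let $\mathscr{A}$ be a nonempty compact IRU-set of positive real $N\times N$ matrices, and let $\tilde{\mathscr{A}}$ be a compact set of real $N\times N$ matrices satisfying $\mathscr{A}\subseteq\tilde{\mathscr{A}}\subseteq\operatorname{co}(\mathscr{A})$, where $\operatorname{co}(\mathscr{A})$ is the convex hull of $\mathscr{A}$. Then: (i) $\check{\rho}_{n}(\tilde{\mathscr{A}})=\rho_{\min}(\mathscr{A})$ for all $n\ge 1$, and therefore $\check{\rho}(\tilde{\mathscr{A}})=\rho_{\min}(\tilde{\mathscr{A}})=\rho_{\min}(\mathscr{A})$; (ii) $\hat{\rho}_{n}(\tilde{\mathscr{A}})=\rho_{\max}(\mathscr{A})$ for all $n\ge 1$, and therefore $\hat{\rho}(\tilde{\mathscr{A}})=\rho_{\max}(\tilde{\mathscr{A}})=\rho_{\max}(\mathscr{A})$.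
   Context: A matrix is positive if all its entries are strictly positive. The set of real $N\times M$ matrices is identified with $\mathbb{R}^{N\times M}$ with its usual topology. A set $\mathscr{A}$ of real $N\times M$ matrices is an independent row uncertainty set (IRU-set) if there are sets of rows $\mathscr{A}_1,\dots,\mathscr{A}_N\subset\mathbb{R}^{M}$ such that $\mathscr{A}$ consists of all $N\times M$ matrices whose $i$-th row belongs to $\mathscr{A}_i$ for each $i=1,\dots,N$. $\rho(A)$ denotes the spectral radius of a square matrix $A$ (maximal modulus of its eigenvalues). For a set $\mathscr{S}$ of $N\times N$ matrices and $n\ge1$: $$\rho_{\min}(\mathscr{S})=\min_{A\in\mathscr{S}}\rho(A),\quad \rho_{\max}(\mathscr{S})=\max_{A\in\mathscr{S}}\rho(A),$$ $$\hat{\rho}_{n}(\mathscr{S})=\sup_{A_1,\dots,A_n\in\mathscr{S}}\rho(A_n\cdots A_1)^{1/n},\quad \check{\rho}_{n}(\mathscr{S})=\inf_{A_1,\dots,A_n\in\mathscr{S}}\rho(A_n\cdots A_1)^{1/n}.$$ The generalized spectral radius of a bounded set $\mathscr{S}$ is $\hat{\rho}(\mathscr{S})=\sup_{n\ge1}\hat{\rho}_n(\mathscr{S})$. The lower spectral radius is $\check{\rho}(\mathscr{S})=\inf_{n\ge1}\check{\rho}_n(\mathscr{S})$, which is known to equal $\lim_{n\to\infty}\inf_{A_i\in\mathscr{S}}\|A_n\cdots A_1\|^{1/n}$ for any operator norm. *)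

theory Defs
  imports "HOL-Analysis.Analysis"
begin

definition positive_matrix :: "real ^ 'm ^ 'n \<Rightarrow> bool" where
  "positive_matrix A \<longleftrightarrow> (\<forall>i j. 0 < A $ i $ j)"

definition iru_set :: "(real ^ 'm ^ 'n) set \<Rightarrow> bool" where
  "iru_set S \<longleftrightarrow> (\<exists>R :: 'n \<Rightarrow> (real ^ 'm) set. S = {A. \<forall>i. row i A \<in> R i})"

definition eigenvalues :: "real ^ 'n ^ 'n \<Rightarrow> complex set" where
  "eigenvalues A = {z. \<exists>v :: complex ^ 'n. v \<noteq> 0 \<and> map_matrix complex_of_real A *v v = z *s v}"

definition spectral_radius :: "real ^ 'n ^ 'n \<Rightarrow> real" where
  "spectral_radius A = Max (cmod ` eigenvalues A)"

text \<open>Minimum and maximum over a possibly infinite set: \<open>LEAST\<close> and \<open>GREATEST\<close> have a specified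
  value only if the extremum is attained, unlike \<open>Inf\<close> and \<open>Sup\<close>; \<open>Min\<close> and \<open>Max\<close> cover
  finite sets only.\<close>

definition rho_min :: "(real ^ 'n ^ 'n) set \<Rightarrow> real" where
  "rho_min S = (LEAST r. r \<in> spectral_radius ` S)"

definition rho_max :: "(real ^ 'n ^ 'n) set \<Rightarrow> real" where
  "rho_max S = (GREATEST r. r \<in> spectral_radius ` S)"

text \<open>The product \<open>A n ** \<dots> ** A 1\<close>; the value \<open>A 0\<close> is not used.\<close>

primrec matrix_prod :: "(nat \<Rightarrow> real ^ 'n ^ 'n) \<Rightarrow> nat \<Rightarrow> real ^ 'n ^ 'n" where
  "matrix_prod A 0 = mat 1"
| "matrix_prod A (Suc n) = A (Suc n) ** matrix_prod A n"

definition rho_hat_n :: "nat \<Rightarrow> (real ^ 'n ^ 'n) set \<Rightarrow> real" where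
  "rho_hat_n n S = Sup {root n (spectral_radius (matrix_prod A n)) | A. \<forall>i\<in>{1..n}. A i \<in> S}"

definition rho_check_n :: "nat \<Rightarrow> (real ^ 'n ^ 'n) set \<Rightarrow> real" where
  "rho_check_n n S = Inf {root n (spectral_radius (matrix_prod A n)) | A. \<forall>i\<in>{1..n}. A i \<in> S}"

definition generalized_spectral_radius :: "(real ^ 'n ^ 'n) set \<Rightarrow> real" where
  "generalized_spectral_radius S = (SUP n\<in>{1..}. rho_hat_n n S)"

definition lower_spectral_radius :: "(real ^ 'n ^ 'n) set \<Rightarrow> real" where
  "lower_spectral_radius S = (INF n\<in>{1..}. rho_check_n n S)"

end

theory Submission
  imports Defs "HOL-Computational_Algebra.Polynomial"
begin

text \<open>Let \<open>F\<close> send \<open>x\<close> to the vector whose \<open>i\<close>-th entry is the largest (or smallest) value of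
  \<open>a \<bullet> x\<close> over the admissible \<open>i\<close>-th rows \<open>a\<close>. Brouwer's theorem on the simplex gives a positive
  eigenvector \<open>v\<close> of \<open>F\<close> with eigenvalue \<open>\<lambda>\<close>. By independence of the rows the extremal rows at
  \<open>v\<close> form a matrix \<open>A\<close> of the set, so \<open>A v = \<lambda> v\<close>, while \<open>B v \<le> \<lambda> v\<close> (or \<open>\<ge>\<close>) for all \<open>B\<close> in
  the set, hence in its convex hull. The inequality passes to products of \<open>n\<close> matrices with \<open>\<lambda>^n\<close>
  in place of \<open>\<lambda>\<close>, and comparison with the positive vector \<open>v\<close> bounds their spectral radii. Powers
  of \<open>A\<close> attain the bound.\<close>

section \<open>Positive eigenvectors\<close>

definition std_simplex :: "(real ^ 'n) set" where
  "std_simplex = {x. (\<forall>i. 0 \<le> x $ i) \<and> (\<Sum>i\<in>UNIV. x $ i) = 1}"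

lemma convex_std_simplex: "convex std_simplex"
  unfolding convex_def std_simplex_def
  by (auto simp: sum.distrib simp flip: sum_distrib_left)

lemma compact_std_simplex: "compact (std_simplex :: (real ^ 'n) set)"
  unfolding compact_eq_bounded_closed
proof
  have "std_simplex \<subseteq> cbox (0 :: real ^ 'n) 1"
  proof
    fix x :: "real ^ 'n" assume x: "x \<in> std_simplex"
    have "x $ i \<le> 1" for i
      using x member_le_sum[of i UNIV "\<lambda>i. x $ i"] by (auto simp: std_simplex_def)
    with x show "x \<in> cbox 0 1" by (simp add: std_simplex_def mem_box_cart)
  qed
  then show "bounded (std_simplex :: (real ^ 'n) set)"
    using bounded_cbox bounded_subset by blast
  show "closed (std_simplex :: (real ^ 'n) set)"
    unfolding std_simplex_def
    by (intro closed_Collect_conj closed_Collect_all closed_Collect_le closed_Collect_eq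
        continuous_intros)
qed

lemma std_simplex_nonempty: "(std_simplex :: (real ^ 'n) set) \<noteq> {}"
proof -
  have "(\<chi> i. 1 / real CARD('n)) \<in> (std_simplex :: (real ^ 'n) set)"
    by (simp add: std_simplex_def)
  then show ?thesis by blast
qed

text \<open>Dividing \<open>F x\<close> by its coordinate sum gives a continuous self-map of the
  simplex, and a Brouwer fixed point is an eigenvector with that sum as eigenvalue. Since
  \<open>F\<close> may be nonlinear, this covers both a single matrix and the rowwise
  extremum.\<close>

lemma positive_map_eigenvector:
  fixes F :: "real ^ 'n \<Rightarrow> real ^ 'n"
  assumes cont: "continuous_on std_simplex F"
    and pos: "\<And>x i. x \<in> std_simplex \<Longrightarrow> 0 < F x $ i"
  obtains v l where "v \<in> std_simplex" "\<And>i. 0 < v $ i" "0 < l" "F v = l *\<^sub>R v"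
proof -
  define s where "s x = (\<Sum>i\<in>UNIV. F x $ i)" for x
  have s: "0 < s x" if "x \<in> std_simplex" for x
    unfolding s_def using pos[OF that] by (intro sum_pos) auto
  have "continuous_on std_simplex (\<lambda>x. inverse (s x) *\<^sub>R F x)"
    unfolding s_def[abs_def]
    by (intro continuous_intros cont) (use s in \<open>force simp: s_def\<close>)
  moreover have "(\<lambda>x. inverse (s x) *\<^sub>R F x) \<in> std_simplex \<rightarrow> std_simplex"
    unfolding Pi_iff
  proof
    fix x :: "real ^ 'n" assume x: "x \<in> std_simplex"
    have "(\<Sum>i\<in>UNIV. inverse (s x) * F x $ i) = inverse (s x) * s x"
      unfolding s_def by (simp add: sum_distrib_left)
    then show "inverse (s x) *\<^sub>R F x \<in> std_simplex"
      using s[OF x] pos[OF x] by (auto simp: std_simplex_def less_imp_le)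
  qed
  ultimately obtain v where v: "v \<in> std_simplex" "inverse (s v) *\<^sub>R F v = v"
    using brouwer[OF compact_std_simplex convex_std_simplex std_simplex_nonempty] by blast
  show ?thesis
  proof
    show "v \<in> std_simplex" by fact
    show "0 < s v" using s v by blast
    have "F v = s v *\<^sub>R (inverse (s v) *\<^sub>R F v)" using s[OF v(1)] by simp
    then show "F v = s v *\<^sub>R v" using v by simp
    \<comment> \<open>The simplex includes its boundary, but a fixed point is a value of the
      normalised map, and these values have positive entries.\<close>
    show "0 < v $ i" for i
    proof -
      have "0 < (inverse (s v) *\<^sub>R F v) $ i" using s pos v(1) by simp
      then show ?thesis by (simp only: v(2))
    qed
  qed
qed

lemma positive_inner_simplex:
  assumes "x \<in> std_simplex" "\<And>j. 0 < a $ j"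
  shows "0 < a \<bullet> (x :: real ^ 'n)"
proof -
  obtain j where "x $ j \<noteq> 0"
    using assms(1) by (cases "\<forall>j. x $ j = 0") (auto simp: std_simplex_def)
  with assms have "0 < x $ j" by (auto simp: std_simplex_def less_le)
  then show ?thesis
    unfolding inner_vec_def using assms
    by (intro sum_pos2[of UNIV j]) (auto simp: std_simplex_def less_imp_le)
qed

lemma matrix_vector_inner_row: "(A *v x) $ i = A $ i \<bullet> (x :: real ^ 'n)"
  by (simp add: matrix_vector_mult_def inner_vec_def)

lemma positive_matrix_eigenvector:
  fixes A :: "real ^ 'n ^ 'n"
  assumes "positive_matrix A"
  obtains v l where "\<And>i. 0 < v $ i" "0 < l" "A *v v = l *\<^sub>R v"
proof (rule positive_map_eigenvector[of "(*v) A"])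
  show "continuous_on std_simplex ((*v) A)"
    by (intro linear_continuous_on matrix_vector_mul_bounded_linear)
  show "0 < (A *v x) $ i" if "x \<in> std_simplex" for x i
    using positive_inner_simplex[OF that] assms
    by (simp add: matrix_vector_inner_row positive_matrix_def)
qed (use that in blast)

section \<open>Extremal rows and the extremal matrix\<close>

lemma continuous_support_function:
  fixes K :: "(real ^ 'n) set"
  assumes "compact K" "K \<noteq> {}"
  obtains g where "continuous_on UNIV g" "\<And>x. \<exists>a\<in>K. g x = a \<bullet> x" "\<And>x a. a \<in> K \<Longrightarrow> a \<bullet> x \<le> g x"
proof -
  have "\<exists>a\<in>K. \<forall>b\<in>K. b \<bullet> x \<le> a \<bullet> x" for x
    by (intro continuous_attains_sup assms continuous_intros)
  then obtain h where h: "\<And>x. h x \<in> K" "\<And>x b. b \<in> K \<Longrightarrow> b \<bullet> x \<le> h x \<bullet> x" by metis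
  obtain M where M: "\<And>a. a \<in> K \<Longrightarrow> norm a \<le> M"
    using compact_imp_bounded[OF assms(1)] bounded_iff by metis
  have M0: "0 \<le> M" using M[OF h(1)] norm_ge_zero order_trans by blast
  \<comment> \<open>The maximiser \<open>h x\<close> at \<open>x\<close> is a competitor at
    \<open>y\<close>, so the increment is at most \<open>h x \<bullet> (x - y)\<close>; a norm bound
    of \<open>K\<close> is thus a Lipschitz constant.\<close>
  have le: "h x \<bullet> x - h y \<bullet> y \<le> M * norm (x - y)" for x y
  proof -
    have "h x \<bullet> x - h y \<bullet> y \<le> h x \<bullet> (x - y)"
      using h(2)[OF h(1), of x y] by (simp add: inner_diff_right)
    also have "\<dots> \<le> norm (h x) * norm (x - y)" by (rule norm_cauchy_schwarz)
    also have "\<dots> \<le> M * norm (x - y)" by (intro mult_right_mono M h) auto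
    finally show ?thesis .
  qed
  have "M-lipschitz_on UNIV (\<lambda>x. h x \<bullet> x)"
  proof (rule lipschitz_onI)
    show "dist (h x \<bullet> x) (h y \<bullet> y) \<le> M * dist x y" for x y
      using le[of x y] le[of y x] by (simp add: dist_norm norm_minus_commute abs_le_iff)
  qed (rule M0)
  then have "continuous_on UNIV (\<lambda>x. h x \<bullet> x)" by (rule lipschitz_on_continuous_on)
  then show ?thesis using h that by blast
qed

text \<open>This is where independence of the rows enters: row \<open>i\<close> may come from a
  different matrix for each \<open>i\<close>.\<close>

lemma iru_set_replace_rows:
  assumes "iru_set S" "\<And>i. M i \<in> S"
  shows "(\<chi> i. M i $ i) \<in> S"
  using assms unfolding iru_set_def row_def by auto

text \<open>The sign \<open>\<sigma> = 1\<close> yields a maximal matrix, \<open>\<sigma> = -1\<close> a minimal one.\<close>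

lemma iru_set_extremal_matrix:
  fixes S :: "(real ^ 'n ^ 'n) set" and \<sigma> :: real
  assumes "S \<noteq> {}" "compact S" "iru_set S" "\<forall>A\<in>S. positive_matrix A" "\<sigma> * \<sigma> = 1"
  obtains v l A where "\<And>i. 0 < v $ i" "0 < l" "A \<in> S" "A *v v = l *\<^sub>R v"
    "\<And>B i. B \<in> S \<Longrightarrow> \<sigma> * (B *v v) $ i \<le> \<sigma> * (l * v $ i)"
proof -
  define K where "K i = (\<lambda>A. \<sigma> *\<^sub>R A $ i) ` S" for i
  have "compact (K i)" "K i \<noteq> {}" for i
    unfolding K_def using assms(1,2)
    by (auto intro!: compact_continuous_image continuous_intros)
  then have "\<exists>g. continuous_on UNIV g \<and> (\<forall>x. \<exists>a\<in>K i. g x = a \<bullet> x) \<and> (\<forall>x. \<forall>a\<in>K i. a \<bullet> x \<le> g x)" for i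
    by (metis continuous_support_function)
  then obtain g where cont: "\<And>i. continuous_on UNIV (g i)"
    and att: "\<And>i x. \<exists>a\<in>K i. g i x = a \<bullet> x" and ub: "\<And>i x a. a \<in> K i \<Longrightarrow> a \<bullet> x \<le> g i x"
    by metis
  \<comment> \<open>The rows in \<open>K i\<close> carry the factor \<open>\<sigma>\<close>;
    multiplying by it again leaves the maximum of the row products for \<open>\<sigma> = 1\<close>
    and the minimum for \<open>\<sigma> = -1\<close>.\<close>
  define F where "F x = (\<chi> i. \<sigma> * g i x)" for x
  have "\<exists>A\<in>S. F x $ i = (A *v x) $ i" for x i
  proof -
    obtain A where "A \<in> S" "g i x = (\<sigma> *\<^sub>R A $ i) \<bullet> x" using att[of i x] by (auto simp: K_def)
    then show ?thesis
      using assms(5) by (auto simp: F_def matrix_vector_inner_row simp flip: mult.assoc)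
  qed
  then obtain M where M: "\<And>x i. M x i \<in> S" "\<And>x i. F x $ i = (M x i *v x) $ i" by metis
  have F_pos: "0 < F x $ i" if "x \<in> std_simplex" for x i
    using positive_inner_simplex[OF that] assms(4) M(1)
    by (simp add: M(2) matrix_vector_inner_row positive_matrix_def)
  have "continuous_on std_simplex F"
    unfolding F_def[abs_def]
    by (intro continuous_intros continuous_on_subset[OF cont]) auto
  then obtain v l where v: "\<And>i. 0 < v $ i" "0 < l" "F v = l *\<^sub>R v"
    using positive_map_eigenvector F_pos by metis
  define A where "A = (\<chi> i. M v i $ i)"
  show ?thesis
  proof
    show "A \<in> S" unfolding A_def using assms(3) M(1) by (rule iru_set_replace_rows)
    have "A *v v = F v" by (simp add: vec_eq_iff A_def M(2) matrix_vector_inner_row)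
    then show "A *v v = l *\<^sub>R v" by (simp add: v)
    show "\<sigma> * (B *v v) $ i \<le> \<sigma> * (l * v $ i)" if "B \<in> S" for B i
    proof -
      have "\<sigma> * (B *v v) $ i \<le> g i v"
        using ub[of "\<sigma> *\<^sub>R B $ i" i v] that by (auto simp: K_def matrix_vector_inner_row)
      also have "g i v = \<sigma> * F v $ i"
        using assms(5) by (simp add: F_def flip: mult.assoc)
      finally show ?thesis by (simp add: v)
    qed
  qed (fact v)+
qed

section \<open>Spectral radius bounds\<close>

text \<open>In the maximum norm weighted by \<open>1 / v $ i\<close>, the nonnegative matrix
  \<open>P\<close> has operator norm at most \<open>c\<close>. Here \<open>t\<close> is the norm of
  the eigenvector \<open>w\<close>, attained at \<open>k\<close>, and the \<open>k\<close>-th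
  coordinate of the eigenvalue equation gives the bound.\<close>

lemma eigenvalue_le_of_subinvariant:
  fixes P :: "real ^ 'n ^ 'n"
  assumes P: "\<And>i j. 0 \<le> P $ i $ j" and v: "\<And>i. 0 < v $ i"
    and le: "\<And>i. (P *v v) $ i \<le> c * v $ i" and z: "z \<in> eigenvalues P"
  shows "cmod z \<le> c"
proof -
  obtain w where w: "w \<noteq> 0" "map_matrix complex_of_real P *v w = z *s w"
    using z by (auto simp: eigenvalues_def)
  define t where "t = (MAX i. cmod (w $ i) / v $ i)"
  have "t \<in> range (\<lambda>i. cmod (w $ i) / v $ i)" unfolding t_def by (rule Max_in) auto
  then obtain k where k: "t = cmod (w $ k) / v $ k" by blast
  have t_ge: "cmod (w $ i) \<le> t * v $ i" for i
  proof -
    have "cmod (w $ i) / v $ i \<le> t" unfolding t_def by (rule Max_ge) auto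
    then show ?thesis using v[of i] by (simp add: field_simps)
  qed
  obtain i where "w $ i \<noteq> 0" using w(1) by (auto simp: vec_eq_iff)
  then have "0 < t * v $ i" using t_ge[of i] by (smt (verit) zero_less_norm_iff)
  then have t0: "0 < t" using v[of i] by (simp add: zero_less_mult_iff)
  have "cmod z * (t * v $ k) = cmod ((z *s w) $ k)"
    using v[of k] by (simp add: k norm_mult)
  also have "\<dots> = cmod (\<Sum>j\<in>UNIV. of_real (P $ k $ j) * w $ j)"
    by (simp add: matrix_vector_mult_def map_matrix_def flip: w(2))
  also have "\<dots> \<le> (\<Sum>j\<in>UNIV. P $ k $ j * cmod (w $ j))"
    by (rule sum_norm_le) (simp add: norm_mult P)
  also have "\<dots> \<le> (\<Sum>j\<in>UNIV. P $ k $ j * (t * v $ j))"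
    by (intro sum_mono mult_left_mono t_ge P)
  also have "\<dots> = t * (P *v v) $ k"
    by (simp add: matrix_vector_mult_def sum_distrib_left algebra_simps)
  also have "\<dots> \<le> t * (c * v $ k)" using t0 le by (intro mult_left_mono) auto
  finally show ?thesis using t0 v[of k] by (simp add: mult.left_commute)
qed

section \<open>Finiteness of the spectrum\<close>

lemma eigenvalues_iff_det:
  "z \<in> eigenvalues A \<longleftrightarrow> det (map_matrix complex_of_real A - mat z) = 0"
proof -
  let ?B = "map_matrix complex_of_real A - mat z"
  have "?B *v v = map_matrix complex_of_real A *v v - z *s v" for v
    by (simp add: vec_eq_iff matrix_vector_mult_def mat_def left_diff_distrib sum_subtractf
        if_distrib[of "\<lambda>x. x * _"] cong: if_cong)
  then have "z \<in> eigenvalues A \<longleftrightarrow> (\<exists>v. v \<noteq> 0 \<and> ?B *v v = 0)"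
    by (simp add: eigenvalues_def)
  also have "\<dots> \<longleftrightarrow> det ?B = 0"
    using invertible_det_nz[of ?B] matrix_left_invertible_ker[of ?B] invertible_left_inverse[of ?B]
    by auto
  finally show ?thesis .
qed

text \<open>The \<open>Max\<close> in \<open>spectral_radius\<close> calls for a finite set. The
  bound \<open>c\<close> supplies a point outside the spectrum, which shows the characteristic
  polynomial to be nonzero without computing its leading coefficient.\<close>

lemma finite_eigenvalues:
  fixes A :: "real ^ 'n ^ 'n"
  assumes "\<And>z. z \<in> eigenvalues A \<Longrightarrow> cmod z \<le> c"
  shows "finite (eigenvalues A)"
proof -
  \<comment> \<open>The Leibniz expansion of the determinant of \<open>A - z I\<close>, with
    polynomials in \<open>z\<close> as entries.\<close>
  define q :: "complex poly" where "q = (\<Sum>p | p permutes (UNIV :: 'n set). of_int (sign p) *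
    (\<Prod>i\<in>UNIV. if i = p i then [:of_real (A $ i $ p i), -1:] else [:of_real (A $ i $ p i):]))"
  have "poly q z = det (map_matrix complex_of_real A - mat z)" for z
    unfolding q_def det_def poly_sum poly_mult poly_prod
    by (intro sum.cong arg_cong2[where f="(*)"] prod.cong) (auto simp: mat_def map_matrix_def)
  then have eq: "eigenvalues A = {z. poly q z = 0}"
    by (auto simp: eigenvalues_iff_det)
  have "of_real (\<bar>c\<bar> + 1) \<notin> eigenvalues A"
    using assms[of "of_real (\<bar>c\<bar> + 1)"] by auto
  then have "q \<noteq> 0" by (auto simp: eq)
  then show ?thesis unfolding eq by (rule poly_roots_finite)
qed

lemma real_eigenvalue:
  fixes A :: "real ^ 'n ^ 'n"
  assumes "A *v v = l *\<^sub>R v" "v \<noteq> 0"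
  shows "of_real l \<in> eigenvalues A"
proof -
  let ?w = "\<chi> i. complex_of_real (v $ i)"
  have "map_matrix complex_of_real A *v ?w = of_real l *s ?w"
    using assms(1)
    by (simp add: vec_eq_iff matrix_vector_mult_def map_matrix_def flip: of_real_mult of_real_sum)
  moreover have "?w \<noteq> 0" using assms(2) by (simp add: vec_eq_iff)
  ultimately show ?thesis unfolding eigenvalues_def by blast
qed

lemma finite_eigenvalues_positive_matrix:
  assumes "positive_matrix P"
  shows "finite (eigenvalues P)"
proof -
  obtain u m where "\<And>i. 0 < u $ i" "P *v u = m *\<^sub>R u"
    using positive_matrix_eigenvector[OF assms] by metis
  then have "cmod z \<le> m" if "z \<in> eigenvalues P" for z
    using eigenvalue_le_of_subinvariant[of P u m z] assms that
    by (simp add: positive_matrix_def less_imp_le)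
  then show ?thesis by (rule finite_eigenvalues)
qed

lemma spectral_radius_le:
  fixes P :: "real ^ 'n ^ 'n"
  assumes P: "positive_matrix P" and v: "\<And>i. 0 < v $ i"
    and le: "\<And>i. (P *v v) $ i \<le> c * v $ i"
  shows "spectral_radius P \<le> c"
proof -
  \<comment> \<open>The eigenvector \<open>u\<close> only serves to show that the set under
    \<open>Max\<close> is nonempty; the bound itself comes from \<open>v\<close>.\<close>
  obtain u m where u: "\<And>i. 0 < u $ i" "P *v u = m *\<^sub>R u"
    using positive_matrix_eigenvector[OF P] by metis
  have "u \<noteq> 0" using u(1) by (metis less_irrefl zero_index)
  then have "eigenvalues P \<noteq> {}" using real_eigenvalue[OF u(2)] by blast
  then show ?thesis
    unfolding spectral_radius_def
    using finite_eigenvalues_positive_matrix[OF P] eigenvalue_le_of_subinvariant[OF _ v le] P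
    by (auto simp: positive_matrix_def less_imp_le)
qed

text \<open>Scale \<open>v\<close> by the largest \<open>t\<close> for which
  \<open>t * v $ i \<le> u $ i\<close> for all \<open>i\<close>, where \<open>u\<close> is a
  positive eigenvector. At an index \<open>k\<close> of equality, applying \<open>P\<close> gives
  \<open>c \<le> m\<close>, and \<open>m\<close> is itself an eigenvalue.\<close>

lemma spectral_radius_ge:
  fixes P :: "real ^ 'n ^ 'n"
  assumes P: "positive_matrix P" and v: "\<And>i. 0 < v $ i"
    and ge: "\<And>i. c * v $ i \<le> (P *v v) $ i"
  shows "c \<le> spectral_radius P"
proof -
  obtain u m where u: "\<And>i. 0 < u $ i" "0 < m" "P *v u = m *\<^sub>R u"
    using positive_matrix_eigenvector[OF P] by metis
  define t where "t = (MIN i. u $ i / v $ i)"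
  have "t \<in> range (\<lambda>i. u $ i / v $ i)" unfolding t_def by (rule Min_in) auto
  then obtain k where k: "t = u $ k / v $ k" by blast
  have t0: "0 < t" using u(1) v by (simp add: k)
  have t_le: "t * v $ i \<le> u $ i" for i
  proof -
    have "t \<le> u $ i / v $ i" unfolding t_def by (rule Min_le) auto
    then show ?thesis using v[of i] by (simp add: field_simps)
  qed
  have "t * (c * v $ k) \<le> t * (P *v v) $ k" using t0 ge by (intro mult_left_mono) auto
  also have "\<dots> = (\<Sum>j\<in>UNIV. P $ k $ j * (t * v $ j))"
    by (simp add: matrix_vector_mult_def sum_distrib_left algebra_simps)
  also have "\<dots> \<le> (\<Sum>j\<in>UNIV. P $ k $ j * u $ j)"
    using P by (intro sum_mono mult_left_mono t_le) (simp add: positive_matrix_def less_imp_le)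
  also have "\<dots> = m * u $ k"
    using arg_cong[OF u(3), of "\<lambda>x. x $ k"] by (simp add: matrix_vector_mult_def)
  also have "\<dots> = t * (m * v $ k)" using v[of k] by (simp add: k)
  finally have "c \<le> m" using t0 v[of k] by simp
  have "u \<noteq> 0" using u(1) by (metis less_irrefl zero_index)
  then have "cmod (of_real m) \<in> cmod ` eigenvalues P"
    using real_eigenvalue[OF u(3)] by blast
  then have "cmod (of_real m) \<le> spectral_radius P"
    unfolding spectral_radius_def
    using finite_eigenvalues_positive_matrix[OF P] by (intro Max_ge) auto
  with \<open>c \<le> m\<close> u(2) show ?thesis by simp
qed

section \<open>Products of positive matrices\<close>

lemma positive_matrix_mult:
  fixes A B :: "real ^ 'n ^ 'n"
  assumes "positive_matrix A" "positive_matrix B"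
  shows "positive_matrix (A ** B)"
  using assms unfolding positive_matrix_def matrix_matrix_mult_def
  by (auto intro!: sum_pos)

lemma positive_matrix_prod:
  assumes "n \<ge> 1" "\<forall>i\<in>{1..n}. positive_matrix (A i)"
  shows "positive_matrix (matrix_prod A n)"
  using assms
proof (induction n rule: nat_induct_at_least)
  case (Suc n)
  then show ?case by (simp add: positive_matrix_mult)
qed simp

text \<open>Matrices with nonnegative entries preserve entrywise inequalities, so each factor
  contributes one \<open>l\<close>. The factor \<open>\<sigma>\<close> stays attached to the
  compared vectors because its sign is not fixed.\<close>

lemma matrix_prod_subinvariant:
  fixes \<sigma> :: real
  assumes l: "0 < l" and pos: "\<forall>i\<in>{1..n}. positive_matrix (A i)"
    and le: "\<forall>i\<in>{1..n}. \<forall>k. \<sigma> * (A i *v v) $ k \<le> \<sigma> * (l * v $ k)"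
  shows "\<sigma> * (matrix_prod A n *v v) $ k \<le> \<sigma> * (l ^ n * v $ k)"
  using pos le
proof (induction n arbitrary: k)
  case (Suc n)
  let ?A = "A (Suc n)" and ?w = "matrix_prod A n *v v"
  have "\<sigma> * (matrix_prod A (Suc n) *v v) $ k = (\<Sum>j\<in>UNIV. ?A $ k $ j * (\<sigma> * ?w $ j))"
    by (simp add: matrix_vector_mul_assoc[symmetric] matrix_vector_mult_def[of ?A] sum_distrib_left
        mult.left_commute)
  also have "\<dots> \<le> (\<Sum>j\<in>UNIV. ?A $ k $ j * (\<sigma> * (l ^ n * v $ j)))"
  proof (intro sum_mono mult_left_mono[of "\<sigma> * _"])
    show "\<sigma> * ?w $ j \<le> \<sigma> * (l ^ n * v $ j)" for j using Suc by simp
    show "0 \<le> ?A $ k $ j" for j using Suc.prems by (simp add: positive_matrix_def less_imp_le)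
  qed
  also have "\<dots> = l ^ n * (\<sigma> * (?A *v v) $ k)"
    by (simp add: matrix_vector_mult_def sum_distrib_left mult_ac)
  also have "\<dots> \<le> l ^ n * (\<sigma> * (l * v $ k))"
    using Suc.prems l by (intro mult_left_mono[of "\<sigma> * _"]) auto
  finally show ?case by (simp add: mult_ac)
qed simp

text \<open>Minimality of the convex hull then carries positivity and the inequality at
  \<open>v\<close> from a set to its hull.\<close>

lemma convex_positive_subinvariant:
  fixes \<sigma> l :: real
  shows "convex {B :: real ^ 'n ^ 'n. positive_matrix B \<and> (\<forall>i. \<sigma> * (B *v v) $ i \<le> \<sigma> * (l * v $ i))}"
proof (rule convexI)
  fix x y :: "real ^ 'n ^ 'n" and a b :: real
  assume x: "x \<in> {B. positive_matrix B \<and> (\<forall>i. \<sigma> * (B *v v) $ i \<le> \<sigma> * (l * v $ i))}"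
    and y: "y \<in> {B. positive_matrix B \<and> (\<forall>i. \<sigma> * (B *v v) $ i \<le> \<sigma> * (l * v $ i))}"
    and ab: "0 \<le> a" "0 \<le> b" "a + b = 1"
  \<comment> \<open>A strict upper bound on convex combinations, applied to the negated entries,
    also covers a zero weight.\<close>
  have "0 < a * x $ i $ j + b * y $ i $ j" for i j
    using x y ab convex_bound_lt[of "- x $ i $ j" 0 "- y $ i $ j" a b]
    by (auto simp: positive_matrix_def)
  moreover have "\<sigma> * ((a *\<^sub>R x + b *\<^sub>R y) *v v) $ i \<le> \<sigma> * (l * v $ i)" for i
  proof -
    have "\<sigma> * ((a *\<^sub>R x + b *\<^sub>R y) *v v) $ i = a * (\<sigma> * (x *v v) $ i) + b * (\<sigma> * (y *v v) $ i)"
      by (simp add: matrix_vector_inner_row inner_add_left algebra_simps)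
    also have "\<dots> \<le> \<sigma> * (l * v $ i)"
      using x y ab by (intro convex_bound_le) auto
    finally show ?thesis .
  qed
  ultimately show "a *\<^sub>R x + b *\<^sub>R y \<in> {B. positive_matrix B \<and> (\<forall>i. \<sigma> * (B *v v) $ i \<le> \<sigma> * (l * v $ i))}"
    by (simp add: positive_matrix_def)
qed

section \<open>Attainment and the joint bound\<close>

lemma spectral_radius_power_eigenvector:
  fixes A :: "real ^ 'n ^ 'n"
  assumes "positive_matrix A" "\<And>i. 0 < v $ i" "0 < l" "A *v v = l *\<^sub>R v" "n \<ge> 1"
  shows "root n (spectral_radius (matrix_prod (\<lambda>_. A) n)) = l"
proof -
  have "matrix_prod (\<lambda>_. A) n *v v = l ^ n *\<^sub>R v"
    by (induction n)
      (auto simp: assms(4) matrix_vector_mult_scaleR simp flip: matrix_vector_mul_assoc)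
  moreover have "positive_matrix (matrix_prod (\<lambda>_. A) n)"
    using assms by (intro positive_matrix_prod) auto
  \<comment> \<open>As an eigenvector of the power, \<open>v\<close> meets the upper and the lower
    estimate at once with \<open>c = l ^ n\<close>.\<close>
  ultimately have "spectral_radius (matrix_prod (\<lambda>_. A) n) = l ^ n"
    using assms(2) by (intro antisym spectral_radius_le[of _ v] spectral_radius_ge[of _ v]) auto
  then show ?thesis using assms by (simp add: real_root_power_cancel)
qed

lemma spectral_radius_eigenvector:
  fixes A :: "real ^ 'n ^ 'n"
  assumes "positive_matrix A" "\<And>i. 0 < v $ i" "A *v v = l *\<^sub>R v"
  shows "spectral_radius A = l"
  using assms by (intro antisym spectral_radius_le[of _ v] spectral_radius_ge[of _ v]) auto

text \<open>The sign treats the maximum (\<open>\<sigma> = 1\<close>) and the minimum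
  (\<open>\<sigma> = -1\<close>) together. One value \<open>l\<close>, attained in \<open>S\<close>,
  bounds products of every length because all estimates use the same vector
  \<open>v\<close>.\<close>

lemma iru_set_joint_bound:
  fixes S T :: "(real ^ 'n ^ 'n) set" and \<sigma> :: real
  assumes "S \<noteq> {}" "compact S" "iru_set S" "\<forall>A\<in>S. positive_matrix A" "T \<subseteq> convex hull S"
    and \<sigma>: "\<sigma> = 1 \<or> \<sigma> = -1"
  obtains l A where "A \<in> S" "spectral_radius A = l"
    "\<forall>B\<in>T. \<sigma> * spectral_radius B \<le> \<sigma> * l"
    "\<forall>n\<ge>1. root n (spectral_radius (matrix_prod (\<lambda>_. A) n)) = l"
    "\<forall>n\<ge>1. \<forall>B. (\<forall>i\<in>{1..n}. B i \<in> T) \<longrightarrow>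
      \<sigma> * root n (spectral_radius (matrix_prod B n)) \<le> \<sigma> * l"
proof -
  have "\<sigma> * \<sigma> = 1" using \<sigma> by auto
  then obtain v l A where v: "\<And>i. 0 < v $ i" and l: "0 < l" and A: "A \<in> S" "A *v v = l *\<^sub>R v"
    and le: "\<And>B i. B \<in> S \<Longrightarrow> \<sigma> * (B *v v) $ i \<le> \<sigma> * (l * v $ i)"
    using iru_set_extremal_matrix[OF assms(1-4)] by blast
  have "convex hull S \<subseteq> {B. positive_matrix B \<and> (\<forall>i. \<sigma> * (B *v v) $ i \<le> \<sigma> * (l * v $ i))}"
    using assms(4) le by (intro hull_minimal convex_positive_subinvariant) auto
  with assms(5) have T: "positive_matrix B" "\<sigma> * (B *v v) $ i \<le> \<sigma> * (l * v $ i)"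
    if "B \<in> T" for B i using that by blast+
  have prod: "\<sigma> * root n (spectral_radius (matrix_prod B n)) \<le> \<sigma> * l"
    if n: "n \<ge> 1" and B: "\<forall>i\<in>{1..n}. B i \<in> T" for n B
  proof -
    let ?P = "matrix_prod B n"
    have P: "positive_matrix ?P" using n B T by (intro positive_matrix_prod) auto
    have sub: "\<sigma> * (?P *v v) $ k \<le> \<sigma> * (l ^ n * v $ k)" for k
      using B T l by (intro matrix_prod_subinvariant) auto
    have root: "root n (l ^ n) = l" using n l by (simp add: real_root_power_cancel)
    show ?thesis
      using \<sigma>
    proof
      assume "\<sigma> = 1"
      moreover from this have "spectral_radius ?P \<le> l ^ n"
        using sub by (intro spectral_radius_le[OF P, of v] v) simp
      then have "root n (spectral_radius ?P) \<le> root n (l ^ n)" using n by simp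
      ultimately show ?thesis by (simp add: root)
    next
      assume "\<sigma> = -1"
      moreover from this have "l ^ n \<le> spectral_radius ?P"
        using sub by (intro spectral_radius_ge[OF P, of v] v) simp
      then have "root n (l ^ n) \<le> root n (spectral_radius ?P)" using n by simp
      ultimately show ?thesis by (simp add: root)
    qed
  qed
  have posA: "positive_matrix A" using A assms(4) by blast
  show ?thesis
  proof
    show "A \<in> S" by fact
    show "spectral_radius A = l"
      by (rule spectral_radius_eigenvector) (use posA v A in auto)
    show "\<forall>B\<in>T. \<sigma> * spectral_radius B \<le> \<sigma> * l"
      \<comment> \<open>A single matrix is a product of length 1, and the first root is the
        identity.\<close>
      using prod[of 1 "\<lambda>_. B" for B] by simp
    show "\<forall>n\<ge>1. root n (spectral_radius (matrix_prod (\<lambda>_. A) n)) = l"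
      using spectral_radius_power_eigenvector[OF posA v l A(2)] by blast
  qed (use prod in blast)
qed

theorem theorem1:
  fixes S T :: "(real ^ 'n ^ 'n) set"
  assumes "S \<noteq> {}" and "compact S" and "iru_set S"
    and "\<forall>A\<in>S. positive_matrix A"
    and "compact T" and "S \<subseteq> T" and "T \<subseteq> convex hull S"
  shows "(\<forall>n\<ge>1. rho_check_n n T = rho_min S)
       \<and> lower_spectral_radius T = rho_min T \<and> rho_min T = rho_min S
       \<and> (\<forall>n\<ge>1. rho_hat_n n T = rho_max S)
       \<and> generalized_spectral_radius T = rho_max T \<and> rho_max T = rho_max S"
proof -
  obtain l A where A: "A \<in> S" "spectral_radius A = l"
    and T: "\<forall>B\<in>T. -1 * spectral_radius B \<le> -1 * l"
    and pow: "\<forall>n\<ge>1. root n (spectral_radius (matrix_prod (\<lambda>_. A) n)) = l"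
    and prod: "\<forall>n\<ge>1. \<forall>B. (\<forall>i\<in>{1..n}. B i \<in> T) \<longrightarrow>
      -1 * root n (spectral_radius (matrix_prod B n)) \<le> -1 * l"
    by (rule iru_set_joint_bound[OF assms(1-4,7) disjI2[OF refl]])
  have "l \<in> spectral_radius ` S" using A by blast
  moreover have "l \<le> y" if "y \<in> spectral_radius ` T" for y using T that by auto
  \<comment> \<open>The value is attained in the smaller set and is a lower bound over the larger
    one, so it is the minimum over both.\<close>
  ultimately have min: "rho_min S = l" "rho_min T = l"
    unfolding rho_min_def using assms(6) by (blast intro!: Least_equality)+
  have check: "rho_check_n n T = l" if "n \<ge> 1" for n
    unfolding rho_check_n_def
  proof (rule cInf_eq_minimum)
    show "l \<in> {root n (spectral_radius (matrix_prod A n)) |A. \<forall>i\<in>{1..n}. A i \<in> T}"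
      using pow that A(1) assms(6) by (intro CollectI exI[of _ "\<lambda>_. A"]) auto
  qed (use prod that in auto)
  have lower: "lower_spectral_radius T = l"
    \<comment> \<open>The infimum runs over a family that is constant for
      \<open>n \<ge> 1\<close>.\<close>
    unfolding lower_spectral_radius_def using check by simp
  obtain l' A' where A': "A' \<in> S" "spectral_radius A' = l'"
    and T': "\<forall>B\<in>T. 1 * spectral_radius B \<le> 1 * l'"
    and pow': "\<forall>n\<ge>1. root n (spectral_radius (matrix_prod (\<lambda>_. A') n)) = l'"
    and prod': "\<forall>n\<ge>1. \<forall>B. (\<forall>i\<in>{1..n}. B i \<in> T) \<longrightarrow>
      1 * root n (spectral_radius (matrix_prod B n)) \<le> 1 * l'"
    by (rule iru_set_joint_bound[OF assms(1-4,7) disjI1[OF refl]])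
  have "l' \<in> spectral_radius ` S" using A' by blast
  moreover have "y \<le> l'" if "y \<in> spectral_radius ` T" for y using T' that by auto
  ultimately have max: "rho_max S = l'" "rho_max T = l'"
    unfolding rho_max_def using assms(6) by (blast intro!: Greatest_equality)+
  have hat: "rho_hat_n n T = l'" if "n \<ge> 1" for n
    unfolding rho_hat_n_def
  proof (rule cSup_eq_maximum)
    show "l' \<in> {root n (spectral_radius (matrix_prod A n)) |A. \<forall>i\<in>{1..n}. A i \<in> T}"
      using pow' that A'(1) assms(6) by (intro CollectI exI[of _ "\<lambda>_. A'"]) auto
  qed (use prod' that in auto)
  have "generalized_spectral_radius T = l'"
    unfolding generalized_spectral_radius_def using hat by simp
  with min check lower max hat show ?thesis by simp
qed

end
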